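(* For every $\varepsilon>0$ there is a constant $C(\varepsilon)>0$ such that the following holds. Let $p$ be a prime, let $K,L$ be integers and $M,N$ positive integers with $\mathcal I=[K+1,K+M]\subseteq[1,p-1]$ and $\mathcal J=[L+1,L+N]\subseteq[1,p-1]$. Then $$\left|\sum_{m\in\mathcal I}\sum_{n\in\mathcal J}\mathcal K_p(mn,1)\right|\le C(\varepsilon)\,(p+MN)\,p^{\varepsilon}.$$
   Context: For a prime $p$ and integers $m,n$, the Kloosterman sum is $\mathcal K_p(m,n)=\sum_{x=1}^{p-1}\exp\!\big(2\pi i (mx+n\overline{x})/p\big)$, where $\overline{x}$ denotes the multiplicative inverse of $x$ modulo $p$. The sums over $m\in\mathcal I$, $n\in\mathcal J$ range over the integers in these intervals. (The paper states the bound as $\ll (p+MN)p^{o(1)}$ for sufficiently large primes $p$, with absolute implied constants.) *)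

theory Defs
  imports
    "HOL-Analysis.Analysis"
    "HOL-Number_Theory.Modular_Inverse"
begin

definition kloosterman_sum :: "int \<Rightarrow> int \<Rightarrow> int \<Rightarrow> complex" where
  "kloosterman_sum p m n =
     (\<Sum>x = 1..p - 1.
        exp (2 * of_real pi * \<i> * of_int (m * x + n * modular_inverse p x) / of_int p))"

end

theory Submission
  imports Defs
begin

text \<open>
  Since \<open>n\<close> is invertible modulo \<open>p\<close>, substituting \<open>n x\<close> for \<open>x\<close> turns \<open>K\<^sub>p(mn, 1)\<close> into
  \<open>K\<^sub>p(m, n)\<close>, so that the double sum becomes \<open>\<Sum>\<^sub>x A(x) B(y)\<close> with two geometric sums
  \<open>A\<close> and \<open>B\<close>, where \<open>x y \<equiv> 1\<close> modulo \<open>p\<close>. Taking \<open>x\<close> and \<open>y\<close> to be residues of least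
  absolute value, one has \<open>|A(x)| \<le> min(M, p/(2|x|))\<close> and likewise for \<open>B\<close>. Group the pairs by the
  integer \<open>k\<close> with \<open>x y = 1 + k p\<close>. At most two pairs have \<open>k = 0\<close>, and each contributes at most
  \<open>M N\<close>. For \<open>k \<noteq> 0\<close> each pair contributes at most \<open>p\<^sup>2/(4|x y|) \<le> p/(2|k|)\<close>, and the number
  of pairs is at most the number of divisors of \<open>1 + k p\<close>, which is \<open>p\<^sup>o\<^sup>(\<^sup>1\<^sup>)\<close>; the sum over
  \<open>0 < |k| \<le> p\<close> costs only a further logarithm.
\<close>

subsection \<open>The divisor bound\<close>

text \<open>A divisor of the product splits as \<open>q ^ i * e\<close> with
  \<open>i \<le> a\<close> and \<open>e dvd m\<close>, so the divisors are covered by the image of a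
  set of pairs.\<close>

lemma card_divisors_prime_power_mult_le:
  fixes q m a :: nat
  assumes "prime q" "m > 0"
  shows "card {d. d dvd q ^ a * m} \<le> (a + 1) * card {d. d dvd m}"
proof -
  have "{d. d dvd q ^ a * m} \<subseteq> (\<lambda>(i, e). q ^ i * e) ` ({..a} \<times> {d. d dvd m})"
  proof
    fix d assume "d \<in> {d. d dvd q ^ a * m}"
    then obtain x y where "d = x * y" "x dvd q ^ a" "y dvd m"
      using division_decomp[of d "q ^ a" m] by auto
    moreover from this obtain i where "i \<le> a" "x = q ^ i"
      using divides_primepow_nat[OF assms(1)] by auto
    ultimately show "d \<in> (\<lambda>(i, e). q ^ i * e) ` ({..a} \<times> {d. d dvd m})"
      by auto
  qed
  hence "card {d. d dvd q ^ a * m} \<le> card ({..a} \<times> {d. d dvd m})"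
    using assms(2) by (intro surj_card_le) auto
  thus ?thesis by (simp add: card_cartesian_product)
qed

text \<open>The contribution of a single prime to the divisor bound. For large \<open>q\<close> one
  has \<open>q powr \<epsilon> \<ge> 2\<close>, so the claim reduces to
  \<open>a + 1 \<le> 2 ^ a\<close>. The remaining \<open>q\<close> are finitely many and are allowed
  a factor that does not depend on \<open>a\<close>; it comes from \<open>1 + t \<le> exp t\<close>
  at \<open>t = a * \<epsilon> * ln 2\<close>.\<close>

lemma Suc_le_powr_prime:
  fixes q a :: nat and \<epsilon> :: real
  assumes "\<epsilon> > 0" "q \<ge> 2"
  shows "real a + 1 \<le> (if q < 2 powr (1 / \<epsilon>) then max 1 (1 / (\<epsilon> * ln 2)) else 1) * real q powr (a * \<epsilon>)"
proof (cases "q < 2 powr (1 / \<epsilon>)")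
  case True
  define D where "D = max 1 (1 / (\<epsilon> * ln 2))"
  have "D * (\<epsilon> * ln 2) \<ge> 1 / (\<epsilon> * ln 2) * (\<epsilon> * ln 2)"
    unfolding D_def using assms by (intro mult_right_mono) auto
  hence "1 \<le> D" "1 \<le> D * (\<epsilon> * ln 2)" using assms by (auto simp: D_def)
  hence "real a + 1 \<le> real a * (D * (\<epsilon> * ln 2)) + D"
    by (intro add_mono mult_right_le_one_le) (auto intro: mult_left_mono[of 1 _ "real a", simplified])
  also have "\<dots> = D * (1 + real a * \<epsilon> * ln 2)" by (simp add: algebra_simps)
  also have "\<dots> \<le> D * exp (real a * \<epsilon> * ln 2)"
    using \<open>1 \<le> D\<close> by (intro mult_left_mono exp_ge_add_one_self) auto
  also have "\<dots> = D * 2 powr (a * \<epsilon>)" by (simp add: powr_def)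
  also have "\<dots> \<le> D * real q powr (a * \<epsilon>)"
    using \<open>1 \<le> D\<close> assms by (intro mult_left_mono powr_mono2) auto
  finally show ?thesis using True by (simp add: D_def)
next
  case False
  have "a + 1 \<le> 2 ^ a" by (induction a) auto
  hence "real (a + 1) \<le> real (2 ^ a)" by (simp only: of_nat_le_iff)
  hence "real a + 1 \<le> 2 powr a" by (simp add: powr_realpow)
  also have "\<dots> = (2 powr (1 / \<epsilon>)) powr (a * \<epsilon>)" using assms by (simp add: powr_powr)
  also have "\<dots> \<le> real q powr (a * \<epsilon>)" using False assms by (intro powr_mono2) auto
  finally show ?thesis using False by simp
qed

text \<open>Multiplying the estimates for the single primes leaves a factor \<open>D\<close> for
  each prime divisor in the finite set \<open>T\<close> and a factor 1 for all others. The product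
  is at most \<open>D ^ card T\<close>, whatever \<open>n\<close> is.\<close>

lemma divisor_bound:
  fixes \<epsilon> :: real
  assumes "\<epsilon> > 0"
  obtains C :: real where "C > 0" "\<And>n::nat. n > 0 \<Longrightarrow> real (card {d. d dvd n}) \<le> C * real n powr \<epsilon>"
proof -
  define D where "D = max 1 (1 / (\<epsilon> * ln 2))"
  define f where "f = (\<lambda>q::nat. if q < 2 powr (1 / \<epsilon>) then D else 1)"
  define T where "T = {q::nat. real q < 2 powr (1 / \<epsilon>)}"
  have D: "D \<ge> 1" by (simp add: D_def)
  have f: "f q \<ge> 1" for q using D by (simp add: f_def)
  \<comment> \<open>Induction on \<open>n\<close>, removing the full power of one prime at each step
    so that this prime does not divide the cofactor \<open>m\<close>.\<close>
  have *: "real (card {d. d dvd n}) \<le> (\<Prod>q\<in>prime_factors n. f q) * real n powr \<epsilon>" if "n > 0" for n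
    using that
  proof (induction n rule: less_induct)
    case (less n)
    show ?case
    proof (cases "n = 1")
      case False
      then obtain q where q: "prime q" "q dvd n" using prime_factor_nat by blast
      define a where "a = multiplicity q n"
      obtain m where m: "n = q ^ a * m" "\<not> q dvd m"
        using multiplicity_decompose'[of n q, folded a_def] not_prime_unit[of q] q(1) less.prems
        by (metis less_irrefl)
      have a: "a > 0" using q less.prems by (simp add: a_def prime_multiplicity_gt_zero_iff)
      have mpos: "m > 0" using m less.prems by (auto intro: Nat.gr0I)
      have "1 < q ^ a" using a prime_gt_1_nat[OF q(1)] by (intro one_less_power)
      hence "m < n" using m mpos by simp
      have pf: "prime_factors n = insert q (prime_factors m)"
        using q(1) a mpos less.prems
        by (auto simp: prime_factors_dvd m(1) prime_dvd_mult_iff prime_dvd_power_iff primes_dvd_imp_eq)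
      have "real (card {d. d dvd n}) \<le> real ((a + 1) * card {d. d dvd m})"
        unfolding m(1) of_nat_le_iff by (rule card_divisors_prime_power_mult_le[OF q(1) mpos])
      also have "\<dots> = (real a + 1) * real (card {d. d dvd m})" by (simp add: algebra_simps)
      also have "\<dots> \<le> (f q * real q powr (a * \<epsilon>)) * ((\<Prod>q\<in>prime_factors m. f q) * real m powr \<epsilon>)"
        using less.IH[OF \<open>m < n\<close> mpos] Suc_le_powr_prime[OF assms, of q a] prime_ge_2_nat[OF q(1)]
          f[of q] unfolding f_def D_def by (intro mult_mono) auto
      also have "\<dots> = (\<Prod>q\<in>prime_factors n. f q) * real n powr \<epsilon>"
      proof -
        have "real n powr \<epsilon> = real q powr (a * \<epsilon>) * real m powr \<epsilon>"
          using prime_gt_0_nat[OF q(1)] by (simp add: m(1) powr_mult powr_powr flip: powr_realpow)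
        moreover have "q \<notin> prime_factors m" using m(2) by auto
        ultimately show ?thesis by (simp add: pf)
      qed
      finally show ?thesis .
    qed auto
  qed
  have T: "finite T"
  proof (rule finite_subset)
    show "T \<subseteq> {..nat \<lceil>2 powr (1 / \<epsilon>)\<rceil>}" unfolding T_def by (auto simp: le_nat_iff) linarith
  qed auto
  show ?thesis
  proof (rule that)
    show "D ^ card T > 0" using D by simp
  next
    fix n :: nat assume n: "n > 0"
    have "(\<Prod>q\<in>prime_factors n. f q) = (\<Prod>q\<in>prime_factors n \<inter> T. D)"
      by (intro prod.mono_neutral_cong_right) (auto simp: f_def T_def)
    also have "\<dots> \<le> D ^ card T"
      using D T by (auto intro!: power_increasing card_mono)
    finally show "real (card {d. d dvd n}) \<le> D ^ card T * real n powr \<epsilon>"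
      using *[OF n] by (meson mult_right_mono order_trans powr_ge_zero)
  qed
qed

text \<open>Every integer divisor is a natural divisor up to sign. Signs matter here because
  residues of least absolute value can be negative.\<close>

lemma card_int_divisors_le:
  fixes l :: int
  assumes "l \<noteq> 0"
  shows "card {d. d dvd l} \<le> 2 * card {d. d dvd nat \<bar>l\<bar>}"
proof -
  let ?D = "{d. d dvd nat \<bar>l\<bar>}"
  have fin: "finite ?D" using assms by (intro finite_divisors_nat) simp
  have "{d. d dvd l} \<subseteq> int ` ?D \<union> (\<lambda>d. - int d) ` ?D"
  proof
    fix d assume "d \<in> {d. d dvd l}"
    hence "nat \<bar>d\<bar> \<in> ?D" using assms by (auto simp: nat_abs_dvd_iff)
    moreover have "d = int (nat \<bar>d\<bar>) \<or> d = - int (nat \<bar>d\<bar>)" by auto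
    ultimately show "d \<in> int ` ?D \<union> (\<lambda>d. - int d) ` ?D" by blast
  qed
  hence "card {d. d dvd l} \<le> card (int ` ?D \<union> (\<lambda>d. - int d) ` ?D)"
    using fin by (intro card_mono) auto
  also have "\<dots> \<le> card ?D + card ?D"
    using fin by (intro order.trans[OF card_Un_le] add_mono card_image_le)
  finally show ?thesis by simp
qed

section \<open>Residues coprime to a prime, and the size of harmonic numbers\<close>

lemma coprime_prime_int:
  fixes p x :: int
  assumes "prime p" "x \<in> {1..p-1}"
  shows "coprime x p"
  using assms prime_imp_coprime_int[of p x] zdvd_not_zless[of x p] by (auto simp: coprime_commute)

text \<open>The sequence \<open>harm n - ln n\<close> decreases and starts at 1.\<close>

lemma harm_le:
  assumes "n > 0"
  shows "harm n \<le> 1 + ln (real n)"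
  using euler_mascheroni_sequence_decreasing[of 1 n] assms by (simp add: harm_def)

subsection \<open>Additive characters and Kloosterman sums\<close>

text \<open>By concavity, sine lies above its chord over \<open>{0..pi/2}\<close>; the point
  \<open>pi * t\<close> has weight \<open>2 * t\<close> at the right end.\<close>

lemma jordan_sin:
  fixes t :: real
  assumes "0 \<le> t" "t \<le> 1/2"
  shows "2 * t \<le> sin (pi * t)"
proof -
  have conc: "concave_on {0..pi/2} sin"
  proof (rule f''_le0_imp_concave)
    show "- sin x \<le> 0" if "x \<in> {0..pi/2}" for x :: real
      using that by (auto intro!: sin_ge_zero)
  qed (auto intro!: derivative_eq_intros)
  have "(1 - 2 * t) * sin 0 + (2 * t) * sin (pi/2) \<le> sin ((1 - 2 * t) *\<^sub>R 0 + (2 * t) *\<^sub>R (pi/2))"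
    by (rule concave_onD[OF conc]) (use assms in auto)
  thus ?thesis by (simp add: mult.commute)
qed

definition add_char :: "int \<Rightarrow> int \<Rightarrow> complex" where
  "add_char p k = cis (2 * pi * of_int k / of_int p)"

lemma add_char_add: "add_char p (k + l) = add_char p k * add_char p l"
  by (simp add: add_char_def cis_mult add_divide_distrib distrib_left)

lemma norm_add_char [simp]: "norm (add_char p k) = 1"
  by (simp add: add_char_def)

lemma add_char_mult_self:
  assumes "p \<noteq> 0"
  shows "add_char p (p * k) = 1"
  using assms cis_multiple_2pi[of "of_int k"] by (simp add: add_char_def mult.assoc)

lemma add_char_cong:
  assumes "p \<noteq> 0" "[k = l] (mod p)"
  shows "add_char p k = add_char p l"
proof -
  obtain d where "k = l + p * d" 
    using assms(2) by (metis cong_iff_lin cong_sym)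
  thus ?thesis using assms(1) by (simp add: add_char_add add_char_mult_self)
qed

lemma add_char_power: "add_char p (of_nat n * a) = add_char p a ^ n"
  by (induction n) (simp_all add: add_char_add distrib_right, simp add: add_char_def)

text \<open>The distance from 1 to a point of the unit circle at angle \<open>u\<close> is
  \<open>2 * \<bar>sin (u / 2)\<bar>\<close>. The condition on \<open>a\<close> keeps the half angle
  \<open>pi * \<bar>a\<bar> / p\<close> within the range of Jordan's inequality.\<close>

lemma norm_add_char_minus_1_ge:
  assumes "p > 0" "2 * \<bar>a\<bar> \<le> p"
  shows "4 * \<bar>of_int a\<bar> / of_int p \<le> norm (add_char p a - 1)"
proof -
  define t where "t = \<bar>of_int a / of_int p :: real\<bar>"
  have "2 * \<bar>real_of_int a\<bar> \<le> of_int p" using assms(2) by linarith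
  hence "2 * t \<le> sin (pi * t)"
    by (intro jordan_sin) (use assms(1) in \<open>auto simp: t_def field_simps abs_mult\<close>)
  also have "\<dots> \<le> \<bar>sin (pi * (of_int a / of_int p))\<bar>"
    unfolding t_def by (cases "of_int a / of_int p \<ge> (0::real)") (simp_all only: abs_of_nonneg abs_of_neg not_le mult_minus_right sin_minus abs_ge_self abs_ge_minus_self)
  also have "2 * \<dots> = norm (add_char p a - 1)"
    using dist_exp_i_1[of "2 * pi * of_int a / of_int p"] 
    by (simp add: add_char_def cis_conv_exp)
  finally show ?thesis using assms(1) by (simp add: t_def)
qed

text \<open>A geometric sum with ratio \<open>z\<close> on the unit circle has norm at most
  \<open>2 / norm (z - 1)\<close>, regardless of its length and starting point.\<close>

lemma norm_sum_add_char_le: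
  assumes "p > 0" "2 * \<bar>a\<bar> \<le> p" "a \<noteq> 0"
  shows "norm (\<Sum>m = K+1..K+M. add_char p (m * a)) \<le> of_int p / (2 * \<bar>of_int a\<bar>)"
proof -
  define z where "z = add_char p a"
  have ge: "4 * \<bar>of_int a\<bar> / of_int p \<le> norm (z - 1)"
    unfolding z_def by (rule norm_add_char_minus_1_ge) fact+
  have pos: "0 < 4 * \<bar>real_of_int a\<bar> / of_int p" using assms by simp
  have z1: "z \<noteq> 1" using ge pos by auto
  have "(\<Sum>m = K+1..K+M. add_char p (m * a)) = (\<Sum>i<nat M. add_char p ((K + 1 + int i) * a))"
    by (rule sum.reindex_bij_witness[of _ "\<lambda>i. K + 1 + int i" "\<lambda>m. nat (m - K - 1)"]) auto
  also have "\<dots> = (\<Sum>i<nat M. add_char p ((K + 1) * a) * z ^ i)"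
    by (simp add: distrib_right add_char_add add_char_power z_def)
  also have "\<dots> = add_char p ((K + 1) * a) * ((z ^ nat M - 1) / (z - 1))"
    using z1 by (simp flip: sum_distrib_left add: geometric_sum)
  also have "norm \<dots> = norm (z ^ nat M - 1) / norm (z - 1)"
    by (simp add: norm_mult norm_divide)
  also have "\<dots> \<le> 2 / (4 * \<bar>of_int a\<bar> / of_int p)"
  proof (rule frac_le)
    show "norm (z ^ nat M - 1) \<le> 2"
      by (rule order.trans[OF norm_triangle_ineq4]) (simp add: z_def norm_power)
  qed (use ge pos in auto)
  finally show ?thesis by simp
qed

section \<open>Kloosterman sums as character sums\<close>

lemma kloosterman_sum_conv_add_char:
  "kloosterman_sum p m n = (\<Sum>x = 1..p - 1. add_char p (m * x + n * modular_inverse p x))"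
  unfolding kloosterman_sum_def add_char_def cis_conv_exp
  by (intro sum.cong refl arg_cong[of _ _ exp]) simp

text \<open>Multiplication by \<open>n\<close> permutes the nonzero residues, and \<open>n\<close>
  times the inverse of \<open>n * x\<close> is the inverse of \<open>x\<close>. On the right-hand
  side \<open>m\<close> and \<open>n\<close> sit in separate summands of the exponent, which is what
  lets the double sum factor.\<close>

lemma kloosterman_sum_mult_left:
  assumes p: "prime p" and n: "coprime n p"
  shows "kloosterman_sum p (m * n) 1 = kloosterman_sum p m n"
proof -
  have p1: "p > 1" using p by (simp add: prime_gt_1_int)
  have "{1..p-1} = {1..<p}" by auto
  moreover have "bij_betw (\<lambda>x. n * x mod p) {1..<p} {1..<p}"
    by (rule bij_betw_int_remainders_mult) fact
  ultimately have bij: "bij_betw (\<lambda>x. n * x mod p) {1..p-1} {1..p-1}" by simp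
  have "kloosterman_sum p m n = 
      (\<Sum>x = 1..p-1. add_char p (m * (n * x mod p) + n * modular_inverse p (n * x mod p)))"
    unfolding kloosterman_sum_conv_add_char
    by (rule sum.reindex_bij_betw[OF bij, symmetric])
  also have "\<dots> = kloosterman_sum p (m * n) 1"
    unfolding kloosterman_sum_conv_add_char
  proof (intro sum.cong refl add_char_cong)
    fix x assume x: "x \<in> {1..p-1}"
    have cx: "coprime x p" by (rule coprime_prime_int[OF p x])
    define y where "y = n * x mod p"
    have y: "[y = n * x] (mod p)" by (simp add: y_def)
    have cy: "coprime y p" using cx n unfolding y_def by (metis coprime_mod_left_iff coprime_mult_left_iff p1 less_numeral_extra(1,3) not_one_less_zero)
    \<comment> \<open>Both inverses become 1 after multiplication by \<open>x\<close>, which is then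
      cancelled.\<close>
    have "[n * modular_inverse p y * x = y * modular_inverse p y] (mod p)"
      using cong_scalar_right[OF cong_sym[OF y], of "modular_inverse p y"] by (simp add: mult_ac)
    also have "[y * modular_inverse p y = 1] (mod p)"
      by (rule cong_modular_inverse1) fact
    also have "[1 = modular_inverse p x * x] (mod p)"
      by (rule cong_sym, rule cong_modular_inverse2) fact
    finally have "[n * modular_inverse p y = modular_inverse p x] (mod p)"
      using cx by (simp add: cong_mult_rcancel)
    moreover have "[m * y = m * n * x] (mod p)"
      using cong_scalar_left[OF y, of m] by (simp add: mult_ac)
    ultimately show "[m * (n * x mod p) + n * modular_inverse p (n * x mod p) = 
            m * n * x + 1 * modular_inverse p x] (mod p)"
      unfolding y_def[symmetric] by (auto intro!: cong_add)
  qed (use p1 in auto)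
  finally show ?thesis by simp
qed

subsection \<open>The double sum\<close>

text \<open>For \<open>x\<close> in \<open>{1..p-1}\<close> this is the representative of least
  absolute value, as the bound for geometric sums requires.\<close>

definition centred_residue :: "int \<Rightarrow> int \<Rightarrow> int" where
  "centred_residue p x = (if 2 * x \<le> p then x else x - p)"

lemma cong_centred_residue: "[centred_residue p x = x] (mod p)"
  by (simp add: centred_residue_def cong_iff_dvd_diff)

lemma abs_centred_residue_le:
  assumes "x \<in> {1..p-1}"
  shows "2 * \<bar>centred_residue p x\<bar> \<le> p"
  using assms by (auto simp: centred_residue_def)

lemma centred_residue_nonzero:
  assumes "x \<in> {1..p-1}"
  shows "centred_residue p x \<noteq> 0"
  using assms by (auto simp: centred_residue_def)

lemma inj_on_centred_residue: "inj_on (centred_residue p) {1..p-1}"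
  by (auto simp: inj_on_def centred_residue_def split: if_splits)

lemma sum_inverse_abs_int:
  "(\<Sum>k\<in>{-int n..int n} - {0}. 1 / \<bar>real_of_int k\<bar>) = 2 * harm n"
proof -
  have "{-int n..int n} - {0} = int ` {1..n} \<union> (\<lambda>k. - int k) ` {1..n}"
  proof (intro equalityI subsetI)
    fix k assume "k \<in> {-int n..int n} - {0}"
    hence "nat \<bar>k\<bar> \<in> {1..n}" "k = int (nat \<bar>k\<bar>) \<or> k = - int (nat \<bar>k\<bar>)" by auto
    thus "k \<in> int ` {1..n} \<union> (\<lambda>k. - int k) ` {1..n}" by blast
  qed auto
  moreover have "int ` {1..n} \<inter> (\<lambda>k. - int k) ` {1..n} = {}" by auto
  ultimately have "(\<Sum>k\<in>{-int n..int n} - {0}. 1 / \<bar>real_of_int k\<bar>) =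
      (\<Sum>k\<in>int ` {1..n}. 1 / \<bar>real_of_int k\<bar>) + (\<Sum>k\<in>(\<lambda>k. - int k) ` {1..n}. 1 / \<bar>real_of_int k\<bar>)"
    by (simp add: sum.union_disjoint)
  also have "\<dots> = 2 * harm n"
    by (simp add: sum.reindex inj_on_def harm_def inverse_eq_divide)
  finally show ?thesis .
qed

text \<open>Once \<open>m\<close> and \<open>n\<close> are separated, interchanging the sums gives a
  product of two geometric sums for each \<open>x\<close>. The assumption on the range of
  \<open>n\<close> makes each \<open>n\<close> coprime to \<open>p\<close>.\<close>

lemma sum_kloosterman_sum_eq:
  assumes p: "prime p" and J: "{L + 1..L + N} \<subseteq> {1..p - 1}"
  shows "(\<Sum>m = K + 1..K + M. \<Sum>n = L + 1..L + N. kloosterman_sum p (m * n) 1) =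
    (\<Sum>x = 1..p - 1. (\<Sum>m = K + 1..K + M. add_char p (m * centred_residue p x)) *
       (\<Sum>n = L + 1..L + N. add_char p (n * centred_residue p (modular_inverse p x))))"
proof -
  have p1: "p > 1" using p by (simp add: prime_gt_1_int)
  have ac: "add_char p (m * x) = add_char p (m * centred_residue p x)" for m x
    using p1 by (intro add_char_cong cong_scalar_left cong_sym[OF cong_centred_residue]) auto
  have "(\<Sum>m = K + 1..K + M. \<Sum>n = L + 1..L + N. kloosterman_sum p (m * n) 1) =
    (\<Sum>m = K + 1..K + M. \<Sum>n = L + 1..L + N. \<Sum>x = 1..p - 1. 
       add_char p (m * centred_residue p x) * add_char p (n * centred_residue p (modular_inverse p x)))"
  proof (intro sum.cong refl)
    fix m n assume "n \<in> {L + 1..L + N}"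
    hence "n \<in> {1..p-1}" using J by auto
    hence "coprime n p" by (rule coprime_prime_int[OF p])
    hence "kloosterman_sum p (m * n) 1 = kloosterman_sum p m n"
      by (rule kloosterman_sum_mult_left[OF p])
    thus "kloosterman_sum p (m * n) 1 = (\<Sum>x = 1..p - 1. 
       add_char p (m * centred_residue p x) * add_char p (n * centred_residue p (modular_inverse p x)))"
      unfolding kloosterman_sum_conv_add_char add_char_add by (simp only: ac[symmetric])
  qed
  also have "\<dots> = (\<Sum>m = K + 1..K + M. \<Sum>x = 1..p - 1. \<Sum>n = L + 1..L + N.
       add_char p (m * centred_residue p x) * add_char p (n * centred_residue p (modular_inverse p x)))"
    by (intro sum.cong refl sum.swap)
  also have "\<dots> = (\<Sum>x = 1..p - 1. \<Sum>m = K + 1..K + M. \<Sum>n = L + 1..L + N.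
       add_char p (m * centred_residue p x) * add_char p (n * centred_residue p (modular_inverse p x)))"
    by (rule sum.swap)
  finally show ?thesis by (simp add: sum_product)
qed

text \<open>The first term is the contribution of \<open>k = 0\<close>. Every other \<open>k\<close>
  contributes at most \<open>C * p powr (1 + 2 * \<delta>) / \<bar>k\<bar>\<close>: the exponent
  \<open>2 * \<delta>\<close> appears because the divisor bound is applied to
  \<open>\<bar>1 + p * k\<bar> \<le> p * p\<close>.\<close>

lemma norm_sum_kloosterman_sum_le:
  fixes C \<delta> :: real
  assumes p: "prime p" and MN: "M > 0" "N > 0" 
    and J: "{L + 1..L + N} \<subseteq> {1..p - 1}"
    and \<delta>: "\<delta> > 0"
    and C: "\<And>n::nat. n > 0 \<Longrightarrow> real (card {d. d dvd n}) \<le> C * real n powr \<delta>"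
  shows "norm (\<Sum>m = K + 1..K + M. \<Sum>n = L + 1..L + N. kloosterman_sum p (m * n) 1)
    \<le> 2 * of_int (M * N) + 2 * C * of_int p powr (1 + 2 * \<delta>) * harm (nat p)"
proof -
  define c where "c = centred_residue p"
  define J where "J = modular_inverse p"
  \<comment> \<open>\<open>h x\<close> is the integer \<open>k\<close> by which the pairs are
    grouped.\<close>
  define h where "h = (\<lambda>x. (c x * c (J x) - 1) div p)"
  define A where "A = (\<lambda>a. \<Sum>m = K + 1..K + M. add_char p (m * a))"
  define B where "B = (\<lambda>a. \<Sum>n = L + 1..L + N. add_char p (n * a))"
  have p1: "p > 1" using p by (simp add: prime_gt_1_int)
  have C0: "C \<ge> 1" using C[of 1] by simp
  have J_mem: "J x \<in> {1..p-1}" and J_cong: "[x * J x = 1] (mod p)" if x: "x \<in> {1..p-1}" for x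
  proof -
    have "coprime x p" by (rule coprime_prime_int[OF p x])
    thus "J x \<in> {1..p-1}" "[x * J x = 1] (mod p)"
      using mult_modular_inverse_int_pos[of p x] modular_inverse_int_less[of p x] p1
        cong_modular_inverse1[of x p] by (auto simp: J_def)
  qed
  have h: "c x * c (J x) = 1 + p * h x" if x: "x \<in> {1..p-1}" for x
  proof -
    have "[c x * c (J x) = x * J x] (mod p)"
      unfolding c_def by (intro cong_mult cong_centred_residue)
    hence "[c x * c (J x) = 1] (mod p)" using J_cong[OF x] cong_trans by blast
    thus ?thesis by (simp add: h_def cong_iff_dvd_diff)
  qed
  have c_le: "2 * \<bar>c x\<bar> \<le> p" "2 * \<bar>c (J x)\<bar> \<le> p" "c x \<noteq> 0" "c (J x) \<noteq> 0" if "x \<in> {1..p-1}" for x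
    using that J_mem[OF that] unfolding c_def
    by (simp_all only: abs_centred_residue_le centred_residue_nonzero not_False_eq_True)
  have prod_le: "\<bar>1 + p * h x\<bar> \<le> p * p" if x: "x \<in> {1..p-1}" for x
  proof -
    have "\<bar>c x\<bar> * \<bar>c (J x)\<bar> \<le> p * p"
      using c_le[OF x] p1 by (intro mult_mono) auto
    thus ?thesis by (simp flip: h[OF x] abs_mult)
  qed
  \<comment> \<open>If \<open>\<bar>h x\<bar> > p\<close>, then
    \<open>\<bar>p * h x\<bar> \<ge> p * p + p\<close>, whereas \<open>prod_le\<close> allows at
    most \<open>p * p + 1\<close>.\<close>
  have h_mem: "h x \<in> {-p..p}" if x: "x \<in> {1..p-1}" for x
  proof (rule ccontr)
    assume "h x \<notin> {-p..p}"
    hence "p * (p + 1) \<le> p * \<bar>h x\<bar>" using p1 by (intro mult_left_mono) auto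
    also have "\<dots> = \<bar>p * h x\<bar>" using p1 by (simp add: abs_mult)
    finally have "p * p + p \<le> \<bar>p * h x\<bar>" by (simp add: algebra_simps)
    thus False using prod_le[OF x] p1 by linarith
  qed
  have card_le: "real (card {x\<in>{1..p-1}. h x = k}) \<le> 2 * (C * \<bar>of_int (1 + p * k)\<bar> powr \<delta>)" for k
  proof -
    let ?l = "1 + p * k"
    have l: "?l \<noteq> 0"
    proof
      assume "?l = 0"
      hence "p dvd 1" by (metis add_eq_0_iff dvd_minus_iff dvd_triv_left minus_minus)
      thus False using p1 by simp
    qed
    \<comment> \<open>\<open>x\<close> is determined by \<open>c x\<close>, which divides
      \<open>1 + p * k\<close>.\<close>
    have "card {x\<in>{1..p-1}. h x = k} \<le> card {d. d dvd ?l}"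
    proof (rule card_inj_on_le)
      show "inj_on c {x\<in>{1..p-1}. h x = k}"
        unfolding c_def by (rule inj_on_subset[OF inj_on_centred_residue]) auto
      show "c ` {x\<in>{1..p-1}. h x = k} \<subseteq> {d. d dvd ?l}"
      proof (intro image_subsetI CollectI)
        fix x assume "x \<in> {x\<in>{1..p-1}. h x = k}"
        hence "?l = c x * c (J x)" using h[of x] by auto
        thus "c x dvd ?l" by (metis dvd_triv_left)
      qed
    qed (use l in simp)
    also have "\<dots> \<le> 2 * card {d. d dvd nat \<bar>?l\<bar>}"
      by (rule card_int_divisors_le) fact
    finally have "real (card {x\<in>{1..p-1}. h x = k}) \<le> 2 * real (card {d. d dvd nat \<bar>?l\<bar>})"
      by linarith
    also have "\<dots> \<le> 2 * (C * real (nat \<bar>?l\<bar>) powr \<delta>)"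
      using C[of "nat \<bar>?l\<bar>"] l by auto
    finally show ?thesis by simp
  qed
  have A_triv: "norm (A a) \<le> of_int M" and B_triv: "norm (B a) \<le> of_int N" for a
    unfolding A_def B_def using MN by (auto intro!: order.trans[OF norm_sum])
  have term0: "norm (A (c x) * B (c (J x))) \<le> of_int (M * N)" for x
    using mult_mono[OF A_triv B_triv] MN by (simp add: norm_mult)
  have termk: "norm (A (c x) * B (c (J x))) \<le> of_int p / (2 * \<bar>of_int (h x)\<bar>)"
    if x: "x \<in> {1..p-1}" and k: "h x \<noteq> 0" for x
  proof -
    \<comment> \<open>Since \<open>\<bar>p * h x\<bar> \<ge> 2\<close>, adding 1 at most halves the
      absolute value. The product of the two residues is therefore at least
      \<open>p * \<bar>h x\<bar> / 2\<close> in absolute value.\<close>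
    have "2 * 1 \<le> p * \<bar>h x\<bar>" using p1 k by (intro mult_mono) auto
    hence "2 \<le> \<bar>p * h x\<bar>" using p1 by (simp add: abs_mult)
    hence "\<bar>p * h x\<bar> \<le> 2 * \<bar>1 + p * h x\<bar>" by (simp add: abs_if split: if_splits)
    hence "real_of_int \<bar>p * h x\<bar> \<le> real_of_int (2 * \<bar>c x * c (J x)\<bar>)"
      unfolding h[OF x] by (simp only: of_int_le_iff)
    hence le: "of_int p * \<bar>real_of_int (h x)\<bar> \<le> 2 * (\<bar>real_of_int (c x)\<bar> * \<bar>real_of_int (c (J x))\<bar>)"
      using p1 by (simp add: abs_mult)
    have "norm (A (c x) * B (c (J x))) \<le> 
        (of_int p / (2 * \<bar>of_int (c x)\<bar>)) * (of_int p / (2 * \<bar>of_int (c (J x))\<bar>))"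
      unfolding norm_mult A_def B_def using c_le[OF x] p1
      by (intro mult_mono norm_sum_add_char_le) auto
    also have "\<dots> = (of_int p * of_int p) / (2 * (2 * (\<bar>of_int (c x)\<bar> * \<bar>of_int (c (J x))\<bar>)))"
      by simp
    also have "\<dots> \<le> (of_int p * of_int p) / (2 * (of_int p * \<bar>of_int (h x)\<bar>))"
      using p1 k c_le[OF x] le by (intro divide_left_mono mult_pos_pos mult_left_mono) auto
    also have "\<dots> = of_int p / (2 * \<bar>of_int (h x)\<bar>)" using p1 by simp
    finally show ?thesis .
  qed
  have inner0: "(\<Sum>x | x \<in> {1..p-1} \<and> h x = 0. norm (A (c x) * B (c (J x)))) \<le> 2 * of_int (M * N)"
  proof -
    \<comment> \<open>Two integers with product 1 are both 1 or both -1, so injectivity of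
      \<open>c\<close> leaves at most two \<open>x\<close>.\<close>
    have "{x\<in>{1..p-1}. h x = 0} = {x\<in>{1..p-1}. c x * c (J x) = 1}" using h p1 by auto
    also have "card \<dots> \<le> card {1, -1::int}"
    proof (rule card_inj_on_le)
      show "inj_on c {x\<in>{1..p-1}. c x * c (J x) = 1}"
        unfolding c_def by (rule inj_on_subset[OF inj_on_centred_residue]) auto
    qed (auto simp: zmult_eq_1_iff)
    finally have "card {x\<in>{1..p-1}. h x = 0} \<le> 2" by simp
    hence "real (card {x\<in>{1..p-1}. h x = 0}) * of_int (M * N) \<le> 2 * of_int (M * N)"
      using MN by (intro mult_right_mono) auto
    thus ?thesis
      by (intro order.trans[OF sum_bounded_above[OF term0]])
  qed
  have innerk: "(\<Sum>x | x \<in> {1..p-1} \<and> h x = k. norm (A (c x) * B (c (J x)))) 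
       \<le> C * of_int p powr (1 + 2 * \<delta>) * (1 / \<bar>of_int k\<bar>)" if k: "k \<noteq> 0" for k
  \<comment> \<open>The bound \<open>\<bar>1 + p * k\<bar> \<le> p * p\<close> comes from an
    \<open>x\<close> with \<open>h x = k\<close> and fails for \<open>k = p\<close>, so empty
    classes are treated apart.\<close>
  proof (cases "\<exists>x\<in>{1..p-1}. h x = k")
    case False
    hence "{x\<in>{1..p-1}. h x = k} = {}" by auto
    thus ?thesis using C0 by (simp only: sum.empty) simp
  next
    case True
    hence "\<bar>1 + p * k\<bar> \<le> p * p" using prod_le by auto
    hence "real_of_int \<bar>1 + p * k\<bar> \<le> real_of_int (p * p)" by (simp only: of_int_le_iff)
    hence "\<bar>real_of_int (1 + p * k)\<bar> powr \<delta> \<le> (of_int p * of_int p) powr \<delta>"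
      using \<delta> by (intro powr_mono2) auto
    also have "\<dots> = of_int p powr (2 * \<delta>)" using p1 by (simp add: powr_mult flip: powr_add)
    finally have card: "real (card {x\<in>{1..p-1}. h x = k}) \<le> 2 * (C * of_int p powr (2 * \<delta>))"
      using card_le[of k] C0 by (meson mult_left_mono order_trans zero_le_numeral zero_le_one)
    have "(\<Sum>x | x \<in> {1..p-1} \<and> h x = k. norm (A (c x) * B (c (J x)))) \<le>
        real (card {x\<in>{1..p-1}. h x = k}) * (of_int p / (2 * \<bar>of_int k\<bar>))"
      using termk k by (intro sum_bounded_above) auto
    also have "\<dots> \<le> 2 * (C * of_int p powr (2 * \<delta>)) * (of_int p / (2 * \<bar>of_int k\<bar>))"
      using card p1 by (intro mult_right_mono) auto
    also have "\<dots> = C * of_int p powr (1 + 2 * \<delta>) * (1 / \<bar>of_int k\<bar>)"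
      using p1 by (simp add: powr_add)
    finally show ?thesis .
  qed
  have "norm (\<Sum>m = K + 1..K + M. \<Sum>n = L + 1..L + N. kloosterman_sum p (m * n) 1) =
      norm (\<Sum>x = 1..p - 1. A (c x) * B (c (J x)))"
    unfolding sum_kloosterman_sum_eq[OF p \<open>{L + 1..L + N} \<subseteq> {1..p - 1}\<close>] A_def B_def c_def J_def ..
  also have "\<dots> \<le> (\<Sum>x = 1..p - 1. norm (A (c x) * B (c (J x))))" by (rule norm_sum)
  also have "\<dots> = (\<Sum>k\<in>{-p..p}. \<Sum>x | x \<in> {1..p-1} \<and> h x = k. norm (A (c x) * B (c (J x))))"
    by (rule sum.group[symmetric]) (use h_mem in auto)
  also have "\<dots> = (\<Sum>x | x \<in> {1..p-1} \<and> h x = 0. norm (A (c x) * B (c (J x)))) +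
      (\<Sum>k\<in>{-p..p}-{0}. \<Sum>x | x \<in> {1..p-1} \<and> h x = k. norm (A (c x) * B (c (J x))))"
    using p1 by (intro sum.remove) auto
  also have "\<dots> \<le> 2 * of_int (M * N) + 
      (\<Sum>k\<in>{-p..p}-{0}. C * of_int p powr (1 + 2 * \<delta>) * (1 / \<bar>of_int k\<bar>))"
    by (intro add_mono inner0 sum_mono innerk) auto
  also have "(\<Sum>k\<in>{-p..p}-{0}. C * of_int p powr (1 + 2 * \<delta>) * (1 / \<bar>of_int k\<bar>)) =
      C * of_int p powr (1 + 2 * \<delta>) * (2 * harm (nat p))"
    using p1 sum_inverse_abs_int[of "nat p"] unfolding sum_distrib_left[symmetric] by simp
  finally show ?thesis by (simp add: mult_ac)
qed

section \<open>Choice of the exponent and of the constant\<close>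

theorem theorem3p1:
  shows "\<forall>\<epsilon>::real. \<epsilon> > 0 \<longrightarrow>
    (\<exists>C::real. C > 0 \<and>
      (\<forall>(p::int) (K::int) (L::int) (M::int) (N::int).
        prime p \<and> M > 0 \<and> N > 0 \<and>
        {K + 1..K + M} \<subseteq> {1..p - 1} \<and> {L + 1..L + N} \<subseteq> {1..p - 1} \<longrightarrow>
        cmod (\<Sum>m = K + 1..K + M. \<Sum>n = L + 1..L + N. kloosterman_sum p (m * n) 1)
          \<le> C * of_int (p + M * N) * of_int p powr \<epsilon>))"
proof (intro allI impI)
  fix \<epsilon> :: real assume \<epsilon>: "\<epsilon> > 0"
  \<comment> \<open>Two of the three parts of \<open>\<epsilon>\<close> pay for the divisor bound at
    numbers up to \<open>p * p\<close>, the third for the logarithm.\<close>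
  define \<delta> where "\<delta> = \<epsilon> / 3"
  have \<delta>: "\<delta> > 0" using \<epsilon> by (simp add: \<delta>_def)
  obtain C where C: "C > 0" "\<And>n::nat. n > 0 \<Longrightarrow> real (card {d. d dvd n}) \<le> C * real n powr \<delta>"
    using divisor_bound[OF \<delta>] by blast
  define D where "D = 2 * C * (1 + 1 / \<delta>)"
  have D: "D > 0" using C \<delta> by (simp add: D_def add_pos_pos)
  show "\<exists>C::real. C > 0 \<and>
      (\<forall>(p::int) (K::int) (L::int) (M::int) (N::int).
        prime p \<and> M > 0 \<and> N > 0 \<and>
        {K + 1..K + M} \<subseteq> {1..p - 1} \<and> {L + 1..L + N} \<subseteq> {1..p - 1} \<longrightarrow>
        cmod (\<Sum>m = K + 1..K + M. \<Sum>n = L + 1..L + N. kloosterman_sum p (m * n) 1)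
          \<le> C * of_int (p + M * N) * of_int p powr \<epsilon>)"
  proof (intro exI[of _ "2 + D"] conjI allI impI)
    fix p K L M N :: int
    assume *: "prime p \<and> M > 0 \<and> N > 0 \<and>
        {K + 1..K + M} \<subseteq> {1..p - 1} \<and> {L + 1..L + N} \<subseteq> {1..p - 1}"
    define P where "P = real_of_int p"
    have P: "P \<ge> 1" using * prime_gt_1_int[of p] by (simp add: P_def)
    have ge1: "1 \<le> P powr t" if "t \<ge> 0" for t using P that by (rule ge_one_powr_ge_zero)
    have "harm (nat p) \<le> 1 + ln P"
      using harm_le[of "nat p"] P by (simp add: P_def)
    \<comment> \<open>The logarithm is absorbed through
      \<open>ln P \<le> P powr \<delta> / \<delta>\<close>, whence the factor
      \<open>1 + 1 / \<delta>\<close> in \<open>D\<close>.\<close>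
    also have "\<dots> \<le> P powr \<delta> + P powr \<delta> / \<delta>"
      using ge1[of \<delta>] \<delta> P by (intro add_mono ln_powr_bound) auto
    finally have harm: "harm (nat p) \<le> (1 + 1 / \<delta>) * P powr \<delta>" by (simp add: algebra_simps)
    have "cmod (\<Sum>m = K + 1..K + M. \<Sum>n = L + 1..L + N. kloosterman_sum p (m * n) 1)
        \<le> 2 * of_int (M * N) + 2 * C * P powr (1 + 2 * \<delta>) * harm (nat p)"
      unfolding P_def using * by (intro norm_sum_kloosterman_sum_le C \<delta>) auto
    also have "\<dots> \<le> 2 * of_int (M * N) + 2 * C * P powr (1 + 2 * \<delta>) * ((1 + 1 / \<delta>) * P powr \<delta>)"
      using C(1) harm by (intro add_left_mono mult_left_mono) auto
    also have "\<dots> = 2 * of_int (M * N) + D * P * P powr \<epsilon>"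
      using P by (simp add: D_def \<delta>_def mult_ac flip: powr_add) (simp add: powr_add)
    \<comment> \<open>The constant \<open>2 + D\<close> dominates both coefficients, and
      \<open>P powr \<epsilon> \<ge> 1\<close> may be inserted into the first term.\<close>
    also have "\<dots> \<le> (2 + D) * (of_int (M * N) * P powr \<epsilon>) + (2 + D) * (P * P powr \<epsilon>)"
    proof (intro add_mono)
      show "2 * of_int (M * N) \<le> (2 + D) * (of_int (M * N) * P powr \<epsilon>)"
        using * D ge1[of \<epsilon>] \<epsilon> by (intro mult_mono) auto
      show "D * P * P powr \<epsilon> \<le> (2 + D) * (P * P powr \<epsilon>)"
        using P D unfolding mult.assoc by (intro mult_right_mono) auto
    qed
    also have "\<dots> = (2 + D) * of_int (p + M * N) * of_int p powr \<epsilon>"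
      by (simp add: P_def algebra_simps)
    finally show "cmod (\<Sum>m = K + 1..K + M. \<Sum>n = L + 1..L + N. kloosterman_sum p (m * n) 1)
          \<le> (2 + D) * of_int (p + M * N) * of_int p powr \<epsilon>" .
  qed (use D in auto)
qed

end
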